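(* Let $A\in\mathbb{R}^{d\times d}$, $S:\mathbb{R}^d\to\mathbb{R}^{d\times d}$ and $V:\mathbb{R}^d\to\mathbb{R}$ be such that the linear gradient DAE $A\dot z=S(z)\nabla V(z)$ is regular with configuration space $\mathcal{M}$ and has uniform index $1$, $V$ is proper for this DAE, and $A^\dagger S(z)$ is skew-symmetric for every $z\in\mathcal{M}$. Let $\{b_i\}_{i=1}^{\ell}$ be an orthonormal basis of $(\mathrm{range}\,A)^\perp$, $B=(b_1,\dots,b_\ell)$ and $G(z)=B^\top S(z)\nabla V(z)$. Let $\Delta t>0$ and let $z^{(0)}\in\mathcal{M}$, and let $z^{(m)}\in\mathbb{R}^d$ ($m=0,1,\dots$), with $c_i^{(m+1)}\in\mathbb{R}$, be the numerical solution of the one-step method $$\begin{cases}A\dfrac{z^{(m+1)}-z^{(m)}}{\Delta t}=\overline S\big(z^{(m+1)},z^{(m)}\big)\,\overline\nabla_{\mathrm P}V\big(z^{(m+1)},z^{(m)}\big)+\sum_{i=1}^{\ell}c_i^{(m+1)}b_i,\\ G\big(z^{(m+1)}\big)=0,\end{cases}$$ where $\overline S(z,z')=\tfrac12\big(S(z)+S(z')\big)$. Then $V(z^{(m+1)})=V(z^{(m)})$ holds for every $m$.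
   Context: $A^\dagger$ is the Moore--Penrose inverse of $A$; $A$ may be singular and $\ell=d-\mathrm{rank}\,A$. A DAE $A\dot z=f(z)$ (here $f(z)=S(z)\nabla V(z)$) is called regular if there are a differentiable submanifold $\mathcal{M}$ of $\mathbb{R}^d$ (the configuration space) and a vector field $v:\mathcal{M}\to T\mathcal{M}$ such that a differentiable map $w:[0,T)\to\mathcal{M}$ is a solution of $\dot w=v(w)$ if and only if $z=j\circ w$ is a solution of the DAE, $j:\mathcal{M}\to\mathbb{R}^d$ being the inclusion. The DAE has uniform index $1$ if and only if $\mathcal{M}=\{z\in\mathbb{R}^d\mid B^\top f(z)=0\}$, i.e. here $\mathcal{M}=\{z\mid G(z)=0\}$. Let $\mathrm{car}(A)=\mathrm{null}(A)^\perp$; a differentiable $V$ is proper for the DAE if $\nabla V(z)\in\mathrm{car}(A)$ for every $z\in\mathcal{M}$. The discrete gradient $\overline\nabla_{\mathrm P}V$ is defined by $\overline\nabla_{\mathrm P}V(z,z')=\theta(z,z')\nabla V(z)+\theta(z',z)\nabla V(z')$ if $z\ne z'$ and $\overline\nabla_{\mathrm P}V(z,z)=\nabla V(z)$, where $$\theta(z,z')=\frac{V(z)-V(z')-\langle\nabla V(z'),z-z'\rangle}{\langle\nabla V(z)-\nabla V(z'),z-z'\rangle}.$$ It is understood that $\overline\nabla_{\mathrm P}V$ is well defined wherever it is used (the denominator is nonzero for the arguments $z\neq z'$ in question; e.g. this holds for all $z\ne z'$ if $V$ is strictly convex). The paper assumes that the scheme has a unique solution for sufficiently small $\Delta t$,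 and $\Delta t$ is taken accordingly. *)

theory Defs
  imports "HOL-Analysis.Analysis"
begin

section \<open>Linear algebra\<close>

definition moore_penrose :: "real^'n^'m \<Rightarrow> real^'m^'n \<Rightarrow> bool" where
  "moore_penrose A X \<longleftrightarrow>
     A ** X ** A = A \<and> X ** A ** X = X \<and>
     transpose (A ** X) = A ** X \<and> transpose (X ** A) = X ** A"

definition pinv :: "real^'n^'m \<Rightarrow> real^'m^'n" where
  "pinv A = (THE X. moore_penrose A X)"

definition skew_symmetric :: "real^'n^'n \<Rightarrow> bool" where
  "skew_symmetric X \<longleftrightarrow> transpose X = - X"

definition car :: "real^'n^'m \<Rightarrow> (real^'n) set" where
  "car A = {x. A *v x = 0}\<^sup>\<bottom>"

text \<open>Families of vectors are indexed by \<open>{..<l}\<close>, so that \<open>l = 0\<close> (a nonsingular matrix) is allowed.\<close>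

definition orthonormal_basis_of :: "nat \<Rightarrow> (nat \<Rightarrow> 'a::euclidean_space) \<Rightarrow> 'a set \<Rightarrow> bool" where
  "orthonormal_basis_of l b W \<longleftrightarrow>
     (\<forall>i<l. \<forall>j<l. b i \<bullet> b j = (if i = j then 1 else 0)) \<and> span (b ` {..<l}) = W"

text \<open>Entry \<open>i\<close> of the vector \<open>B\<^sup>T x\<close>, where \<open>B\<close> is the matrix with columns
  \<open>b 0, \<dots>, b (l - 1)\<close>; only the entries \<open>i < l\<close> are meaningful.\<close>

definition BT :: "(nat \<Rightarrow> 'a::euclidean_space) \<Rightarrow> 'a \<Rightarrow> nat \<Rightarrow> real" where
  "BT b x i = b i \<bullet> x"


section \<open>Submanifolds of a Euclidean space\<close>

definition C1_on :: "('a::euclidean_space \<Rightarrow> 'b::euclidean_space) \<Rightarrow> 'a set \<Rightarrow> bool" where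
  "C1_on g U \<longleftrightarrow>
     (\<exists>g' :: 'a \<Rightarrow> 'a \<Rightarrow>\<^sub>L 'b.
        (\<forall>x\<in>U. (g has_derivative blinfun_apply (g' x)) (at x)) \<and> continuous_on U g')"

text \<open>Embedded submanifolds, of class \<open>C\<^sup>1\<close>: near each of its points the set is
  flattened to a \<open>k\<close>-dimensional linear subspace by a \<open>C\<^sup>1\<close> diffeomorphism
  between open sets of the ambient space.\<close>

definition submanifold :: "'a::euclidean_space set \<Rightarrow> bool" where
  "submanifold M \<longleftrightarrow>
     (\<exists>k. \<forall>p\<in>M. \<exists>U W \<phi> \<psi> (L :: 'a set).
        open U \<and> p \<in> U \<and> open W \<and> homeomorphism U W \<phi> \<psi> \<and> C1_on \<phi> U \<and> C1_on \<psi> W \<and>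
        subspace L \<and> dim L = k \<and> \<phi> ` (U \<inter> M) = W \<inter> L)"

text \<open>The tangent space consists of the velocities of differentiable curves in the set.\<close>

definition tangent_space :: "'a::euclidean_space set \<Rightarrow> 'a \<Rightarrow> 'a set" where
  "tangent_space M p =
     {u. \<exists>\<gamma> e. e > 0 \<and> \<gamma> ` {-e<..<e} \<subseteq> M \<and> \<gamma> differentiable_on {-e<..<e} \<and>
               \<gamma> 0 = p \<and> (\<gamma> has_vector_derivative u) (at 0)}"

definition vector_field_on :: "'a::euclidean_space set \<Rightarrow> ('a \<Rightarrow> 'a) \<Rightarrow> bool" where
  "vector_field_on M v \<longleftrightarrow> (\<forall>p\<in>M. v p \<in> tangent_space M p)"


section \<open>Differential-algebraic equations\<close>

definition ODE_solution :: "('a::euclidean_space \<Rightarrow> 'a) \<Rightarrow> real \<Rightarrow> (real \<Rightarrow> 'a) \<Rightarrow> bool" where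
  "ODE_solution v T w \<longleftrightarrow>
     (\<forall>t\<in>{0..<T}. (w has_vector_derivative v (w t)) (at t within {0..<T}))"

definition DAE_solution ::
  "real^'n^'n \<Rightarrow> (real^'n \<Rightarrow> real^'n) \<Rightarrow> real \<Rightarrow> (real \<Rightarrow> real^'n) \<Rightarrow> bool" where
  "DAE_solution A f T z \<longleftrightarrow>
     (\<forall>t\<in>{0..<T}. \<exists>z'. (z has_vector_derivative z') (at t within {0..<T}) \<and> A *v z' = f (z t))"

text \<open>The DAE \<open>A z' = f(z)\<close> is regular with configuration space \<open>M\<close>. A differentiable map
  into the embedded submanifold \<open>M\<close> is a differentiable map into the ambient space with
  values in \<open>M\<close>, so the inclusion is left implicit.\<close>

definition regular_DAE ::
  "real^'n^'n \<Rightarrow> (real^'n \<Rightarrow> real^'n) \<Rightarrow> (real^'n) set \<Rightarrow> bool" where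
  "regular_DAE A f M \<longleftrightarrow>
     submanifold M \<and>
     (\<exists>v. vector_field_on M v \<and>
       (\<forall>T>0. \<forall>w. w ` {0..<T} \<subseteq> M \<and> w differentiable_on {0..<T} \<longrightarrow>
          (ODE_solution v T w \<longleftrightarrow> DAE_solution A f T w)))"

text \<open>Uniform index 1, for \<open>B\<close> with columns an orthonormal basis of the orthogonal complement of
  the range of the matrix of the DAE.\<close>

definition uniform_index_one ::
  "nat \<Rightarrow> (nat \<Rightarrow> 'a::euclidean_space) \<Rightarrow> ('a \<Rightarrow> 'a) \<Rightarrow> 'a set \<Rightarrow> bool" where
  "uniform_index_one l b f M \<longleftrightarrow> M = {z. \<forall>i<l. BT b (f z) i = 0}"


section \<open>Gradients and discrete gradients\<close>

definition gradient :: "('a::euclidean_space \<Rightarrow> real) \<Rightarrow> 'a \<Rightarrow> 'a" where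
  "gradient V z = (THE g. GDERIV V z :> g)"

definition proper_for ::
  "real^'n^'n \<Rightarrow> (real^'n) set \<Rightarrow> (real^'n \<Rightarrow> real) \<Rightarrow> bool" where
  "proper_for A M V \<longleftrightarrow>
     (\<forall>z. V differentiable (at z)) \<and> (\<forall>z\<in>M. gradient V z \<in> car A)"

definition theta :: "('a::euclidean_space \<Rightarrow> real) \<Rightarrow> 'a \<Rightarrow> 'a \<Rightarrow> real" where
  "theta V z z' =
     (V z - V z' - gradient V z' \<bullet> (z - z')) / ((gradient V z - gradient V z') \<bullet> (z - z'))"

text \<open>Meaningful for \<open>z \<noteq> z'\<close> only if the denominator of \<open>theta\<close> is nonzero; this denominator is
  symmetric in \<open>z\<close> and \<open>z'\<close>.\<close>

definition discrete_gradient :: "('a::euclidean_space \<Rightarrow> real) \<Rightarrow> 'a \<Rightarrow> 'a \<Rightarrow> 'a" where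
  "discrete_gradient V z z' =
     (if z = z' then gradient V z
      else theta V z z' *\<^sub>R gradient V z + theta V z' z *\<^sub>R gradient V z')"

definition discrete_gradient_defined :: "('a::euclidean_space \<Rightarrow> real) \<Rightarrow> 'a \<Rightarrow> 'a \<Rightarrow> bool" where
  "discrete_gradient_defined V z z' \<longleftrightarrow>
     (z \<noteq> z' \<longrightarrow> (gradient V z - gradient V z') \<bullet> (z - z') \<noteq> 0)"

definition average :: "(real^'n \<Rightarrow> real^'n^'n) \<Rightarrow> real^'n \<Rightarrow> real^'n \<Rightarrow> real^'n^'n" where
  "average S z z' = (1/2) *\<^sub>R (S z + S z')"

end

theory Submission
  imports Defs
begin

text \<open>Along the scheme the discrete gradient \<open>g\<close> satisfies the discrete chain rule
  \<open>V z' - V z = g \<bullet> (z' - z)\<close> and, both points lying on the configuration space, stays in the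
  subspace \<open>car A\<close>. Since \<open>A\<^sup>\<dagger> A\<close> is the orthogonal projection onto \<open>car A\<close>, the increment of
  \<open>V\<close> equals \<open>g \<bullet> A\<^sup>\<dagger> A (z' - z)\<close>. Inserting the scheme, the multiplier terms vanish because
  \<open>A\<^sup>\<dagger>\<close> annihilates the orthogonal complement of the range of \<open>A\<close>, and what is left is the
  quadratic form of a skew-symmetric matrix.\<close>

lemma skew_symmetric_add:
  assumes "skew_symmetric X" "skew_symmetric Y"
  shows "skew_symmetric (X + Y)"
proof -
  have "transpose (X + Y) = transpose X + transpose Y"
    by (simp add: transpose_def vec_eq_iff)
  then show ?thesis
    using assms by (simp add: skew_symmetric_def)
qed

lemma skew_symmetric_scaleR: "skew_symmetric X \<Longrightarrow> skew_symmetric (r *\<^sub>R X)"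
  by (simp add: skew_symmetric_def transpose_scalar)

lemma skew_symmetric_inner_self:
  assumes "skew_symmetric X"
  shows "x \<bullet> (X *v x) = 0"
proof -
  have "(- X) *v x = - (X *v x)"
    using matrix_vector_mult_diff_rdistrib[of 0 X x] by simp
  then have "x \<bullet> (X *v x) = - (X *v x) \<bullet> x"
    using assms dot_lmul_matrix[of x X x]
    by (simp add: skew_symmetric_def del: transpose_matrix_vector flip: transpose_matrix_vector)
  then show ?thesis
    by (simp add: inner_commute)
qed

text \<open>\<open>transpose A ** A\<close> and \<open>A\<close> have the same null space: if
  \<open>transpose A *v (A *v y) = 0\<close>, pairing with \<open>y\<close> shows that
  \<open>A *v y\<close> has norm zero.\<close>

lemma matrix_mul_transpose_cancel:
  fixes A :: "real^'n^'m" and P Q :: "real^'k^'n"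
  assumes "transpose A ** A ** P = transpose A ** A ** Q"
  shows "A ** P = A ** Q"
proof -
  have "A *v (P *v x) = A *v (Q *v x)" for x
  proof -
    let ?y = "P *v x - Q *v x"
    have "transpose A *v (A *v ?y) = 0"
      using arg_cong[OF assms, of "\<lambda>C. C *v x"]
      by (simp add: matrix_vector_mult_diff_distrib flip: matrix_vector_mul_assoc)
    then have "(A *v ?y) \<bullet> (A *v ?y) = 0"
      using dot_lmul_matrix[of "A *v ?y" A ?y] by simp
    then show ?thesis
      by (simp add: matrix_vector_mult_diff_distrib)
  qed
  then show ?thesis
    by (simp add: matrix_eq matrix_vector_mul_assoc)
qed

lemma generalized_inverse_exists:
  fixes A :: "real^'n^'m"
  obtains X :: "real^'m^'n" where "A ** X ** A = A"
proof -
  obtain g where g: "linear g" "\<forall>v\<in>range ((*v) A). A *v g v = v"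
    using linear_exists_right_inverse_on[of "(*v) A" UNIV] by auto
  have "A ** matrix g ** A = A"
    using g by (simp add: matrix_eq matrix_works flip: matrix_vector_mul_assoc)
  then show thesis by (rule that)
qed

text \<open>The witness is \<open>(A\<^sup>T A)\<^sup>- A\<^sup>T\<close> for an arbitrary generalized inverse of \<open>A\<^sup>T A\<close>.\<close>

lemma least_squares_inverse_exists:
  fixes A :: "real^'n^'m"
  obtains L :: "real^'m^'n" where "A ** L ** A = A" "transpose (A ** L) = A ** L"
proof -
  let ?T = "transpose A"
  obtain X where X: "?T ** A ** X ** (?T ** A) = ?T ** A"
    by (rule generalized_inverse_exists)
  define L where "L = X ** ?T"
  have "?T ** A ** (L ** A) = ?T ** A ** mat 1"
    using X by (simp add: L_def matrix_mul_assoc)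
  then have ALA: "A ** L ** A = A"
    using matrix_mul_transpose_cancel[of A "L ** A" "mat 1"] by (simp add: matrix_mul_assoc)
  \<comment> \<open>\<open>transpose A ** A\<close> is symmetric, so \<open>transpose X\<close> is a
    generalized inverse of it as well.\<close>
  have "?T ** A ** (transpose X ** (?T ** A)) = ?T ** A ** mat 1"
    using arg_cong[OF X, of transpose] by (simp add: matrix_transpose_mul matrix_mul_assoc)
  then have AXTA: "A ** transpose X ** ?T ** A = A"
    using matrix_mul_transpose_cancel[of A "transpose X ** (?T ** A)" "mat 1"]
    by (simp add: matrix_mul_assoc)
  have TAL: "?T ** A ** L = ?T"
    using arg_cong[OF AXTA, of transpose]
    by (simp add: L_def matrix_transpose_mul matrix_mul_assoc)
  \<comment> \<open>The symmetric matrix \<open>transpose L ** transpose A ** A ** L\<close> equals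
    both \<open>transpose (A ** L)\<close> and \<open>A ** L\<close>.\<close>
  have "transpose (A ** L) = transpose L ** (?T ** A ** L)"
    by (simp add: TAL matrix_transpose_mul)
  also have "\<dots> = transpose (transpose L ** (?T ** A ** L))"
    by (simp add: matrix_transpose_mul matrix_mul_assoc)
  also have "\<dots> = A ** L"
    by (simp add: TAL matrix_transpose_mul)
  finally show thesis
    using ALA that by blast
qed

text \<open>Take generalized inverses \<open>L\<close> with \<open>A ** L\<close> symmetric and
  \<open>K\<close> with \<open>K ** A\<close> symmetric. Then \<open>K ** A ** L\<close> has both
  symmetries, since multiplying it by \<open>A\<close> gives \<open>A ** L\<close> on the left and
  \<open>K ** A\<close> on the right.\<close>

lemma moore_penrose_exists: "\<exists>X. moore_penrose A X"
proof -
  obtain L where L: "A ** L ** A = A" "transpose (A ** L) = A ** L"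
    by (rule least_squares_inverse_exists)
  \<comment> \<open>\<open>K\<close> arises by transposing the same construction for
    \<open>transpose A\<close>.\<close>
  obtain K' where K': "transpose A ** K' ** transpose A = transpose A"
    "transpose (transpose A ** K') = transpose A ** K'"
    by (rule least_squares_inverse_exists)
  define K where "K = transpose K'"
  have K: "A ** K ** A = A" "transpose (K ** A) = K ** A"
    using arg_cong[OF K'(1), of transpose] K'(2)
    by (simp_all add: K_def matrix_transpose_mul matrix_mul_assoc)
  have AX: "A ** (K ** A ** L) = A ** L"
    using K(1) by (simp add: matrix_mul_assoc)
  have XA: "K ** A ** L ** A = K ** A"
    using L(1) by (metis matrix_mul_assoc)
  have "K ** A ** L ** A ** (K ** A ** L) = K ** A ** L"
    unfolding XA using AX by (metis matrix_mul_assoc)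
  then have "moore_penrose A (K ** A ** L)"
    using AX XA K L by (simp add: moore_penrose_def)
  then show ?thesis ..
qed

text \<open>\<open>A ** X\<close> and \<open>A ** Y\<close> are both the orthogonal projection onto
  the range of \<open>A\<close>, hence equal; \<open>X ** A\<close> and \<open>Y ** A\<close> agree
  likewise, which suffices because \<open>X = X ** A ** X\<close>.\<close>

lemma moore_penrose_unique:
  assumes X: "moore_penrose A X" and Y: "moore_penrose A Y"
  shows "X = Y"
proof -
  have "A ** X = transpose (A ** Y ** (A ** X))"
    using X Y by (simp add: moore_penrose_def matrix_mul_assoc)
  also have "\<dots> = A ** X ** (A ** Y)"
    using X Y by (simp add: moore_penrose_def matrix_transpose_mul[of "A ** Y"])
  also have "\<dots> = A ** Y"
    using X by (simp add: moore_penrose_def matrix_mul_assoc)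
  finally have AX: "A ** X = A ** Y" .
  have "X ** A = transpose (X ** A ** (Y ** A))"
    using X Y by (metis moore_penrose_def matrix_mul_assoc)
  also have "\<dots> = Y ** A ** (X ** A)"
    using X Y by (simp add: moore_penrose_def matrix_transpose_mul[of "X ** A"])
  also have "\<dots> = Y ** A"
    using X by (metis moore_penrose_def matrix_mul_assoc)
  finally have XA: "X ** A = Y ** A" .
  have "X = X ** A ** X"
    using X by (simp add: moore_penrose_def)
  also have "\<dots> = Y ** A ** Y"
    by (metis AX XA matrix_mul_assoc)
  also have "\<dots> = Y"
    using Y by (simp add: moore_penrose_def)
  finally show ?thesis .
qed

lemma moore_penrose_pinv: "moore_penrose A (pinv A)"
proof -
  have "\<exists>!X. moore_penrose A X"
    using moore_penrose_exists moore_penrose_unique by (rule ex_ex1I)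
  then show ?thesis
    unfolding pinv_def by (rule theI')
qed

text \<open>Symmetry of \<open>A ** pinv A\<close> lets \<open>transpose A\<close> be split off as
  the rightmost factor of \<open>pinv A\<close>, and it kills the orthogonal complement of the
  range.\<close>

lemma pinv_orthogonal_range:
  assumes "x \<in> (range (\<lambda>y. A *v y))\<^sup>\<bottom>"
  shows "pinv A *v x = 0"
proof -
  have "(transpose A *v x) \<bullet> y = 0" for y
    using assms dot_lmul_matrix[of x A y]
    by (simp add: orthogonal_comp_def orthogonal_def inner_commute[of x])
  then have T: "transpose A *v x = 0"
    using inner_eq_zero_iff by blast
  have "pinv A = pinv A ** transpose (A ** pinv A)"
    using moore_penrose_pinv[of A] by (simp add: moore_penrose_def matrix_mul_assoc)
  then have "pinv A *v x = (pinv A ** (transpose (pinv A) ** transpose A)) *v x"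
    by (simp add: matrix_transpose_mul)
  also have "\<dots> = 0"
    using T by (simp only: matrix_vector_mul_assoc[symmetric] matrix_vector_mult_0_right)
  finally show ?thesis .
qed

text \<open>\<open>h - pinv A *v (A *v h)\<close> lies in the null space of \<open>A\<close>, to
  which \<open>g\<close> is orthogonal.\<close>

lemma inner_pinv_car:
  assumes "g \<in> car A"
  shows "g \<bullet> (pinv A *v (A *v h)) = g \<bullet> h"
proof -
  have "A *v (h - pinv A *v (A *v h)) = 0"
    using moore_penrose_pinv[of A]
    by (simp add: moore_penrose_def matrix_vector_mult_diff_distrib matrix_vector_mul_assoc
        matrix_mul_assoc)
  then have "(h - pinv A *v (A *v h)) \<bullet> g = 0"
    using assms by (simp add: car_def orthogonal_comp_def orthogonal_def)
  then show ?thesis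
    by (simp add: inner_diff_left inner_commute[of g])
qed

text \<open>The numerators of the two weights add up to their common denominator.\<close>

lemma theta_swap:
  assumes "(gradient V z - gradient V z') \<bullet> (z - z') \<noteq> 0"
  shows "theta V z' z = 1 - theta V z z'"
proof -
  have "(gradient V z' - gradient V z) \<bullet> (z' - z) = (gradient V z - gradient V z') \<bullet> (z - z')"
    by (simp add: algebra_simps)
  then show ?thesis
    using assms by (simp add: theta_def divide_simps) (simp add: algebra_simps)
qed

lemma discrete_chain_rule:
  assumes "discrete_gradient_defined V z z'"
  shows "discrete_gradient V z z' \<bullet> (z - z') = V z - V z'"
proof (cases "z = z'")
  case False
  let ?h = "z - z'"
  have nz: "(gradient V z - gradient V z') \<bullet> ?h \<noteq> 0"
    using assms False by (simp add: discrete_gradient_defined_def)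
  \<comment> \<open>Since the weights sum to 1, only \<open>theta V z z'\<close> remains, multiplied
    by exactly its own denominator.\<close>
  have "discrete_gradient V z z' \<bullet> ?h =
      theta V z z' * ((gradient V z - gradient V z') \<bullet> ?h) + gradient V z' \<bullet> ?h"
    using False
    by (simp add: discrete_gradient_def theta_swap[OF nz] inner_add_left inner_diff_left
        algebra_simps del: inner_diff_right)
  then show ?thesis
    using nz by (simp add: theta_def)
qed simp

lemma discrete_gradient_in_car:
  assumes "gradient V z \<in> car A" "gradient V z' \<in> car A"
  shows "discrete_gradient V z z' \<in> car A"
  using assms unfolding discrete_gradient_def car_def
  by (simp add: subspace_add subspace_scale subspace_orthogonal_comp)

theorem theorem7p3:
  fixes A :: "real^'d^'d"
    and S :: "real^'d \<Rightarrow> real^'d^'d"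
    and V :: "real^'d \<Rightarrow> real"
    and M :: "(real^'d) set"
    and l :: nat
    and b :: "nat \<Rightarrow> real^'d"
    and G :: "real^'d \<Rightarrow> nat \<Rightarrow> real"
    and dt :: real
    and z :: "nat \<Rightarrow> real^'d"
    and c :: "nat \<Rightarrow> nat \<Rightarrow> real"
  assumes l: "l = CARD('d) - rank A"
    and b: "orthonormal_basis_of l b ((range (\<lambda>x. A *v x))\<^sup>\<bottom>)"
    and G: "\<And>y. G y = BT b (S y *v gradient V y)"
    and regular: "regular_DAE A (\<lambda>y. S y *v gradient V y) M"
    and index_one: "uniform_index_one l b (\<lambda>y. S y *v gradient V y) M"
    and proper: "proper_for A M V"
    and skew: "\<And>y. y \<in> M \<Longrightarrow> skew_symmetric (pinv A ** S y)"
    and dt: "dt > 0"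
    and z0: "z 0 \<in> M"
    and defined: "\<And>m. discrete_gradient_defined V (z (Suc m)) (z m)"
    and step: "\<And>m. A *v ((1 / dt) *\<^sub>R (z (Suc m) - z m)) =
        average S (z (Suc m)) (z m) *v discrete_gradient V (z (Suc m)) (z m)
        + (\<Sum>i<l. c (Suc m) i *\<^sub>R b i)"
    and constraint: "\<And>m. \<forall>i<l. G (z (Suc m)) i = 0"
  shows "\<forall>m. V (z (Suc m)) = V (z m)"
proof
  fix m
  let ?z = "z m" and ?z' = "z (Suc m)"
  let ?g = "discrete_gradient V ?z' ?z" and ?S = "average S ?z' ?z"
  let ?r = "\<Sum>i<l. c (Suc m) i *\<^sub>R b i"
  \<comment> \<open>By uniform index 1 the constraint places every iterate after the initial one in
    \<open>M\<close>.\<close>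
  have inM: "z k \<in> M" for k
  proof (cases k)
    case (Suc n)
    then show ?thesis
      using index_one constraint[of n] by (simp add: uniform_index_one_def G)
  qed (simp add: z0)
  have car: "?g \<in> car A"
    using proper inM by (intro discrete_gradient_in_car) (auto simp: proper_for_def)
  \<comment> \<open>The factor \<open>pinv A\<close> is constant, so skew-symmetry at the two
    iterates passes to the average.\<close>
  have "pinv A ** ?S = (1/2) *\<^sub>R (pinv A ** S ?z' + pinv A ** S ?z)"
    by (simp add: average_def matrix_add_ldistrib matrix_scalar_ac scaleR_add_right flip: scalar_matrix_assoc)
  then have skew': "skew_symmetric (pinv A ** ?S)"
    using skew inM by (simp add: skew_symmetric_add skew_symmetric_scaleR)
  have "?r \<in> span (b ` {..<l})"
    by (intro span_sum span_scale span_base) simp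
  then have r: "pinv A *v ?r = 0"
    using b by (intro pinv_orthogonal_range) (simp add: orthonormal_basis_of_def)
  \<comment> \<open>Scaling by \<open>1 / dt\<close> produces the difference quotient to which the
    scheme applies \<open>A\<close>.\<close>
  have "(1 / dt) * (V ?z' - V ?z) = ?g \<bullet> ((1 / dt) *\<^sub>R (?z' - ?z))"
    using discrete_chain_rule[OF defined[of m]] by simp
  also have "\<dots> = ?g \<bullet> (pinv A *v (?S *v ?g + ?r))"
    using inner_pinv_car[OF car] step[of m] by metis
  also have "\<dots> = ?g \<bullet> ((pinv A ** ?S) *v ?g)"
    using r by (simp add: matrix_vector_right_distrib matrix_vector_mul_assoc)
  also have "\<dots> = 0"
    using skew' by (rule skew_symmetric_inner_self)
  finally show "V ?z' = V ?z"
    using dt by simp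
qed

end
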